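(* Let $\Gamma$ be a compact Lie group acting linearly on a finite-dimensional complex vector space $V$, let $m\ge 2$, let $\sigma:\Gamma\to \mathbf{Z}_m$ be a group epimorphism, and let $H=\ker\sigma$. Then the following direct sum decomposition of $\mathcal{P}(\Gamma)$-modules holds: $$\mathcal{P}(H)=\mathcal{P}(\Gamma)\oplus \mathcal{P}_{\sigma}(\Gamma)\oplus\cdots\oplus\mathcal{P}_{\sigma^{m-1}}(\Gamma).$$
   Context: $\mathbf{Z}_m\subset\mathbf{C}^{*}$ denotes the multiplicative cyclic group of the $m$-th roots of unity, so $\sigma$ is regarded as a complex-valued function on $\Gamma$, and $\sigma^j(\gamma)=\sigma(\gamma)^j$. Polynomial functions on $V$ are complex-valued functions $V\to\mathbf{C}$ that are polynomial in the coordinates of $V$ and their complex conjugates (i.e. complex-valued polynomial functions on the underlying real vector space). For a subgroup $K\le\Gamma$, $\mathcal{P}(K)$ is the ring of polynomial functions $f:V\to\mathbf{C}$ with $f(\gamma x)=f(x)$ for all $\gamma\in K$, $x\in V$. For $j\in\{0,\ldots,m-1\}$, $\mathcal{P}_{\sigma^j}(\Gamma)$ is the set of $\sigma^j$-relative invariant polynomial functions, i.e. polynomial functions $f:V\to\mathbf{C}$ with $f(\gamma x)=\sigma^j(\gamma)f(x)$ for all $\gamma\in\Gamma$, $x\in V$; it is a module over $\mathcal{P}(\Gamma)$, and $\mathcal{P}_{\sigma^0}(\Gamma)=\mathcal{P}(\Gamma)$. Each $\mathcal{P}_{\sigma^j}(\Gamma)$ is a $\mathcal{P}(\Gamma)$-submodule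 of $\mathcal{P}(H)$. *)

theory Defs
  imports
    "HOL-Analysis.Analysis"
    "HOL-Algebra.Group_Action"
    "HOL-Algebra.Module"
begin

section \<open>Lie groups\<close>

text \<open>
  The model spaces are the topologies \<open>Euclidean_space n\<close>, whose points are the
  \<open>x :: nat \<Rightarrow> real\<close> with \<open>x i = 0\<close> for \<open>i \<ge> n\<close>.  Unlike a type of class
  \<open>euclidean_space\<close> they include dimension 0, so finite groups are Lie groups.
\<close>

text \<open>
  \<open>Ck_on n k S f\<close>: all iterated partial derivatives of \<open>f\<close> of order at most \<open>k\<close>
  exist on the open set \<open>S\<close> and those of order \<open>k\<close> are continuous.
\<close>

fun Ck_on :: "nat \<Rightarrow> nat \<Rightarrow> (nat \<Rightarrow> real) set \<Rightarrow> ((nat \<Rightarrow> real) \<Rightarrow> real) \<Rightarrow> bool" where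
  "Ck_on n 0 S f \<longleftrightarrow> continuous_map (subtopology (Euclidean_space n) S) euclideanreal f"
| "Ck_on n (Suc k) S f \<longleftrightarrow>
     (\<forall>i<n. (\<forall>x\<in>S. (\<lambda>t. f (x(i := t))) differentiable at (x i)) \<and>
            Ck_on n k S (\<lambda>x. deriv (\<lambda>t. f (x(i := t))) (x i)))"

definition smooth_map_on ::
  "nat \<Rightarrow> nat \<Rightarrow> (nat \<Rightarrow> real) set \<Rightarrow> ((nat \<Rightarrow> real) \<Rightarrow> (nat \<Rightarrow> real)) \<Rightarrow> bool" where
  "smooth_map_on n p S F \<longleftrightarrow>
     openin (Euclidean_space n) S \<and> (\<forall>j<p. \<forall>k. Ck_on n k S (\<lambda>x. F x j))"

definition chart ::
  "'g topology \<Rightarrow> nat \<Rightarrow> 'g set \<Rightarrow> ('g \<Rightarrow> nat \<Rightarrow> real) \<Rightarrow> bool" where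
  "chart T n U \<phi> \<longleftrightarrow>
     openin T U \<and> openin (Euclidean_space n) (\<phi> ` U) \<and>
     homeomorphic_map (subtopology T U) (subtopology (Euclidean_space n) (\<phi> ` U)) \<phi>"

text \<open>The two halves of a point of dimension \<open>n + n\<close>.\<close>

definition left_half :: "nat \<Rightarrow> (nat \<Rightarrow> real) \<Rightarrow> nat \<Rightarrow> real" where
  "left_half n z = (\<lambda>i. if i < n then z i else 0)"

definition right_half :: "nat \<Rightarrow> (nat \<Rightarrow> real) \<Rightarrow> nat \<Rightarrow> real" where
  "right_half n z = (\<lambda>i. if i < n then z (n + i) else 0)"

text \<open>
  \<open>A\<close> is a smooth atlas on the space \<open>T\<close>.  In \<open>smooth_inv\<close> and \<open>smooth_mult\<close> the
  condition \<open>smooth_map_on\<close> includes openness of the domain of the local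
  representative, i.e. of a preimage of a chart domain, so continuity of the group
  operations is part of these assumptions.
\<close>

locale lie_group = group G for G :: "('g, 'm) monoid_scheme" (structure) +
  fixes T :: "'g topology" and n :: nat and A :: "('g set \<times> ('g \<Rightarrow> nat \<Rightarrow> real)) set"
  assumes topspace_eq: "topspace T = carrier G"
    and Hausdorff: "Hausdorff_space T"
    and second_countable: "second_countable T"
    and charts: "\<And>U \<phi>. (U, \<phi>) \<in> A \<Longrightarrow> chart T n U \<phi>"
    and charts_cover: "(\<Union>(U, \<phi>)\<in>A. U) = carrier G"
    and smooth_transition: "\<And>U \<phi> V \<psi>. (U, \<phi>) \<in> A \<Longrightarrow> (V, \<psi>) \<in> A \<Longrightarrow>
      smooth_map_on n n (\<phi> ` (U \<inter> V)) (\<lambda>x. \<psi> (inv_into U \<phi> x))"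
    and smooth_inv: "\<And>U \<phi> V \<psi>. (U, \<phi>) \<in> A \<Longrightarrow> (V, \<psi>) \<in> A \<Longrightarrow>
      smooth_map_on n n
        (\<phi> ` {g \<in> U. inv g \<in> V})
        (\<lambda>x. \<psi> (inv (inv_into U \<phi> x)))"
    and smooth_mult: "\<And>U \<phi> V \<psi> W \<xi>. (U, \<phi>) \<in> A \<Longrightarrow> (V, \<psi>) \<in> A \<Longrightarrow> (W, \<xi>) \<in> A \<Longrightarrow>
      smooth_map_on (n + n) n
        {z \<in> topspace (Euclidean_space (n + n)).
           left_half n z \<in> \<phi> ` U \<and> right_half n z \<in> \<psi> ` V \<and>
           inv_into U \<phi> (left_half n z) \<otimes> inv_into V \<psi> (right_half n z) \<in> W}
        (\<lambda>z. \<xi> (inv_into U \<phi> (left_half n z) \<otimes> inv_into V \<psi> (right_half n z)))"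

locale compact_lie_group = lie_group +
  assumes compact: "compact_space T"


section \<open>Linear actions on a finite-dimensional complex vector space\<close>

text \<open>
  The space \<open>V\<close> is the type \<open>'v\<close> with scalar multiplication \<open>scl\<close> and a finite basis
  \<open>B\<close>.
\<close>

definition coord ::
  "(complex \<Rightarrow> 'v::ab_group_add \<Rightarrow> 'v) \<Rightarrow> 'v set \<Rightarrow> 'v \<Rightarrow> 'v \<Rightarrow> complex" where
  "coord scl B b v = Modules.module.representation scl B v b"

text \<open>
  The usual topology of \<open>V\<close>, transported from the product topology along the coordinate
  map (coordinates with index outside \<open>B\<close> are constantly 0).
\<close>

definition vs_topology ::
  "(complex \<Rightarrow> 'v::ab_group_add \<Rightarrow> 'v) \<Rightarrow> 'v set \<Rightarrow> 'v topology" where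
  "vs_topology scl B =
     pullback_topology UNIV (\<lambda>v b. coord scl B b v) (product_topology (\<lambda>_. euclidean) UNIV)"

locale linear_lie_group_action =
  compact_lie_group G T n A + finite_dimensional_vector_space scl B + group_action G UNIV \<rho>
  for G :: "('g, 'm) monoid_scheme" (structure)
    and T :: "'g topology" and n :: nat and A :: "('g set \<times> ('g \<Rightarrow> nat \<Rightarrow> real)) set"
    and scl :: "complex \<Rightarrow> 'v::ab_group_add \<Rightarrow> 'v" and B :: "'v set"
    and \<rho> :: "'g \<Rightarrow> 'v \<Rightarrow> 'v" +
  assumes linear_action: "\<And>g. g \<in> carrier G \<Longrightarrow> Vector_Spaces.linear scl scl (\<rho> g)"
    and continuous_action:
      "continuous_map (prod_topology T (vs_topology scl B)) (vs_topology scl B)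
         (\<lambda>(g, v). \<rho> g v)"

definition root_group :: "nat \<Rightarrow> complex monoid" where
  "root_group m = \<lparr>carrier = {z. z ^ m = 1}, monoid.mult = (*), one = 1\<rparr>"


section \<open>Invariant and relative invariant polynomial functions\<close>

inductive poly_fun ::
  "(complex \<Rightarrow> 'v::ab_group_add \<Rightarrow> 'v) \<Rightarrow> 'v set \<Rightarrow> ('v \<Rightarrow> complex) \<Rightarrow> bool"
  for scl B where
  const: "poly_fun scl B (\<lambda>_. c)"
| coord: "b \<in> B \<Longrightarrow> poly_fun scl B (coord scl B b)"
| cnj_coord: "b \<in> B \<Longrightarrow> poly_fun scl B (\<lambda>v. cnj (coord scl B b v))"
| add: "poly_fun scl B f \<Longrightarrow> poly_fun scl B g \<Longrightarrow> poly_fun scl B (\<lambda>v. f v + g v)"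
| mult: "poly_fun scl B f \<Longrightarrow> poly_fun scl B g \<Longrightarrow> poly_fun scl B (\<lambda>v. f v * g v)"

definition invariant_polys ::
  "(complex \<Rightarrow> 'v::ab_group_add \<Rightarrow> 'v) \<Rightarrow> 'v set \<Rightarrow> ('g \<Rightarrow> 'v \<Rightarrow> 'v) \<Rightarrow> 'g set \<Rightarrow>
   ('v \<Rightarrow> complex) set" where
  "invariant_polys scl B \<rho> K = {f. poly_fun scl B f \<and> (\<forall>g\<in>K. \<forall>x. f (\<rho> g x) = f x)}"

definition rel_invariant_polys ::
  "(complex \<Rightarrow> 'v::ab_group_add \<Rightarrow> 'v) \<Rightarrow> 'v set \<Rightarrow> ('g \<Rightarrow> 'v \<Rightarrow> 'v) \<Rightarrow> 'g set \<Rightarrow>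
   ('g \<Rightarrow> complex) \<Rightarrow> ('v \<Rightarrow> complex) set" where
  "rel_invariant_polys scl B \<rho> K \<xi> =
     {f. poly_fun scl B f \<and> (\<forall>g\<in>K. \<forall>x. f (\<rho> g x) = \<xi> g * f x)}"

definition fun_ring :: "('v \<Rightarrow> complex) set \<Rightarrow> ('v \<Rightarrow> complex) ring" where
  "fun_ring C =
     \<lparr>carrier = C, monoid.mult = (\<lambda>f g v. f v * g v), one = (\<lambda>_. 1),
      zero = (\<lambda>_. 0), add = (\<lambda>f g v. f v + g v)\<rparr>"

text \<open>
  The pointwise multiplication \<open>smult\<close> makes \<open>fun_module C\<close> a module over \<open>fun_ring D\<close>
  whenever \<open>D\<close> is a ring of functions with \<open>D \<sqdot> C \<subseteq> C\<close>.
\<close>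

definition fun_module ::
  "('v \<Rightarrow> complex) set \<Rightarrow> ('v \<Rightarrow> complex, 'v \<Rightarrow> complex) module" where
  "fun_module C =
     \<lparr>carrier = C, monoid.mult = (\<lambda>f g v. f v * g v), one = (\<lambda>_. 1),
      zero = (\<lambda>_. 0), add = (\<lambda>f g v. f v + g v), smult = (\<lambda>f g v. f v * g v)\<rparr>"

definition internal_direct_sum ::
  "('a, 'r) ring_scheme \<Rightarrow> ('a, 'b, 's) module_scheme \<Rightarrow> 'i set \<Rightarrow> ('i \<Rightarrow> 'b set) \<Rightarrow> bool" where
  "internal_direct_sum R M I N \<longleftrightarrow>
     Module.module R M \<and> (\<forall>i\<in>I. submodule (N i) R M) \<and>
     (\<forall>x\<in>carrier M. \<exists>!f. f \<in> Pi\<^sub>E I N \<and> x = finsum M f I)"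

end

theory Submission
  imports Defs
begin

text \<open>
  A function \<open>f\<close> invariant under \<open>ker \<sigma>\<close> depends on \<open>\<rho> g\<close> only through \<open>\<sigma> g\<close>, so that
  \<open>F \<zeta> = f \<circ> \<rho> g\<close> with \<open>\<sigma> g = \<zeta>\<close> is well defined on the \<open>m\<close>-th roots of unity.  Its discrete
  Fourier coefficient \<open>1/m * (\<Sum>\<zeta>. \<zeta>\<^sup>-\<^sup>j * F \<zeta>)\<close> is relatively invariant for \<open>\<sigma>\<^sup>j\<close>, and Fourier
  inversion at \<open>\<zeta> = 1\<close> writes \<open>f\<close> as the sum of its coefficients.  Conversely, if
  \<open>\<Sum>j<m. d j = 0\<close> with \<open>d j\<close> relatively invariant for \<open>\<sigma>\<^sup>j\<close>, then evaluating along an orbit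
  gives \<open>\<Sum>j<m. d j x * \<zeta>\<^sup>j = 0\<close> at all \<open>m\<close> roots of unity, a polynomial of degree less than
  \<open>m\<close> with \<open>m\<close> zeros; hence every \<open>d j\<close> vanishes.
\<close>

section \<open>Roots of unity\<close>

lemma sum_powers_root_unity:
  fixes z :: "'a::field"
  assumes "z ^ m = 1"
  shows "(\<Sum>j<m. z ^ j) = (if z = 1 then of_nat m else 0)"
  using assms by (auto simp: sum_gp_strict)

text \<open>Division by \<open>\<eta>\<close> is the inverse map. This is the change of variable in
  the Fourier sum when a group element acts on the argument.\<close>

lemma roots_unity_times_bij:
  fixes \<eta> :: "'a::field"
  assumes "\<eta> ^ m = 1" "m > 0"
  shows "bij_betw (\<lambda>\<zeta>. \<zeta> * \<eta>) {\<zeta>. \<zeta> ^ m = 1} {\<zeta>. \<zeta> ^ m = 1}"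
proof -
  have "\<eta> \<noteq> 0"
    using assms by (auto simp: power_0_left)
  then show ?thesis
    using assms by (intro bij_betwI[where g = "\<lambda>\<zeta>. \<zeta> / \<eta>"])
      (auto simp: power_mult_distrib power_divide)
qed

lemma coeffs_zero_if_vanishing_at_roots_unity:
  fixes c :: "nat \<Rightarrow> complex"
  assumes m: "m > 0" and zero: "\<And>\<zeta>. \<zeta> ^ m = 1 \<Longrightarrow> (\<Sum>j<m. c j * \<zeta> ^ j) = 0" and "j < m"
  shows "c j = 0"
proof (rule ccontr)
  assume "c j \<noteq> 0"
  \<comment> \<open>The root bound is stated for sums up to and including the degree, here
    \<open>m - 1\<close>; the two index sets agree only because \<open>m > 0\<close>.\<close>
  have eq: "{..<m} = {..m - 1}"
    using m by auto
  from \<open>c j \<noteq> 0\<close> \<open>j < m\<close> have "finite {z. (\<Sum>i\<le>m - 1. c i * z ^ i) = 0} \<and>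
      card {z. (\<Sum>i\<le>m - 1. c i * z ^ i) = 0} \<le> m - 1"
    by (intro polyfun_rootbound exI[of _ j]) auto
  moreover have "{z. z ^ m = 1} \<subseteq> {z. (\<Sum>i\<le>m - 1. c i * z ^ i) = 0}"
    using zero eq by auto
  ultimately have "card {z::complex. z ^ m = 1} \<le> m - 1"
    by (meson card_mono order_trans)
  then show False
    using card_roots_unity_eq[OF m] m by simp
qed

section \<open>Polynomial functions\<close>

lemma poly_fun_uminus: "poly_fun scl B f \<Longrightarrow> poly_fun scl B (\<lambda>v. - f v)"
  using poly_fun.mult[OF poly_fun.const[of scl B "-1"]] by simp

lemma poly_fun_sum:
  "(\<And>i. i \<in> I \<Longrightarrow> poly_fun scl B (f i)) \<Longrightarrow> poly_fun scl B (\<lambda>v. \<Sum>i\<in>I. f i v)"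
  by (induction I rule: infinite_finite_induct) (auto intro: poly_fun.const poly_fun.add)

text \<open>The numbers \<open>coord scl B b (L c)\<close> are the matrix entries of
  \<open>L\<close> in the basis \<open>B\<close>.\<close>

lemma coord_linear_image:
  assumes "finite_dimensional_vector_space scl B" "Vector_Spaces.linear scl scl L"
  shows "coord scl B b (L v) = (\<Sum>c\<in>B. coord scl B c v * coord scl B b (L c))"
proof -
  interpret finite_dimensional_vector_space scl B
    by fact
  interpret L: Vector_Spaces.linear scl scl L
    by fact
  have "L v = L (\<Sum>c\<in>B. scl (representation B v c) c)"
    by (simp add: sum_representation_eq independent_Basis span_Basis finite_Basis)
  also have "\<dots> = (\<Sum>c\<in>B. scl (representation B v c) (L c))"
    by (simp add: L.sum L.scale)
  finally show ?thesis
    by (simp add: coord_def representation_sum representation_scale independent_Basis span_Basis)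
qed

text \<open>It suffices to treat the generators: a coordinate of \<open>L v\<close> is a
  constant-coefficient combination of the coordinates of \<open>v\<close>, and its conjugate is one
  of the conjugate coordinates. This makes translates of a polynomial function by the action
  polynomial again.\<close>

lemma poly_fun_linear_image:
  assumes "finite_dimensional_vector_space scl B" "poly_fun scl B f"
    and "Vector_Spaces.linear scl scl L"
  shows "poly_fun scl B (\<lambda>v. f (L v))"
proof -
  have eq: "(\<lambda>v. coord scl B b (L v)) =
      (\<lambda>v. \<Sum>c\<in>B. coord scl B c v * coord scl B b (L c))" for b
    by (intro ext coord_linear_image assms)
  have cnj_eq: "(\<lambda>v. cnj (coord scl B b (L v))) =
      (\<lambda>v. \<Sum>c\<in>B. cnj (coord scl B c v) * cnj (coord scl B b (L c)))" for b
    by (rule ext, subst coord_linear_image[OF assms(1,3)]) simp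
  from assms(2) show ?thesis
  proof induction
    case (coord b)
    show ?case
      by (subst eq, rule poly_fun_sum, rule poly_fun.mult[OF poly_fun.coord poly_fun.const])
  next
    case (cnj_coord b)
    show ?case
      by (subst cnj_eq, rule poly_fun_sum,
          rule poly_fun.mult[OF poly_fun.cnj_coord poly_fun.const])
  qed (simp_all add: poly_fun.const poly_fun.add poly_fun.mult)
qed

section \<open>Rings and modules of functions\<close>

lemma cring_fun_ring:
  assumes "(\<lambda>_. 0) \<in> D" "(\<lambda>_. 1) \<in> D" "\<And>f. f \<in> D \<Longrightarrow> (\<lambda>v. - f v) \<in> D"
    and "\<And>f g. f \<in> D \<Longrightarrow> g \<in> D \<Longrightarrow> (\<lambda>v. f v + g v) \<in> D"
    and "\<And>f g. f \<in> D \<Longrightarrow> g \<in> D \<Longrightarrow> (\<lambda>v. f v * g v) \<in> D"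
  shows "cring (fun_ring D)"
proof (intro cringI abelian_groupI comm_monoidI)
  fix f
  assume "f \<in> carrier (fun_ring D)"
  then show "\<exists>g\<in>carrier (fun_ring D). g \<oplus>\<^bsub>fun_ring D\<^esub> f = \<zero>\<^bsub>fun_ring D\<^esub>"
    using assms(3) by (intro bexI[of _ "\<lambda>v. - f v"]) (auto simp: fun_ring_def)
qed (auto simp: fun_ring_def algebra_simps intro: assms)

lemma abelian_group_fun_module:
  assumes "(\<lambda>_. 0) \<in> C" "\<And>f. f \<in> C \<Longrightarrow> (\<lambda>v. - f v) \<in> C"
    and "\<And>f g. f \<in> C \<Longrightarrow> g \<in> C \<Longrightarrow> (\<lambda>v. f v + g v) \<in> C"
  shows "abelian_group (fun_module C)"
proof (intro abelian_groupI)
  fix f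
  assume "f \<in> carrier (fun_module C)"
  then show "\<exists>g\<in>carrier (fun_module C). g \<oplus>\<^bsub>fun_module C\<^esub> f = \<zero>\<^bsub>fun_module C\<^esub>"
    using assms(2) by (intro bexI[of _ "\<lambda>v. - f v"]) (auto simp: fun_module_def)
qed (auto simp: fun_module_def algebra_simps intro: assms)

lemma module_fun_module:
  assumes "cring (fun_ring D)" "abelian_group (fun_module C)"
    and "\<And>f g. f \<in> D \<Longrightarrow> g \<in> C \<Longrightarrow> (\<lambda>v. f v * g v) \<in> C"
  shows "Module.module (fun_ring D) (fun_module C)"
  using assms by (intro moduleI) (auto simp: fun_ring_def fun_module_def algebra_simps)

lemma a_inv_fun_module:
  assumes "abelian_group (fun_module C)" "f \<in> C" "(\<lambda>v. - f v) \<in> C"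
  shows "\<ominus>\<^bsub>fun_module C\<^esub> f = (\<lambda>v. - f v)"
proof -
  interpret abelian_group "fun_module C"
    by fact
  show ?thesis
    by (rule minus_equality) (use assms(2,3) in \<open>auto simp: fun_module_def\<close>)
qed

text \<open>Reduces decompositions in the abstract module to identities between complex numbers at
  each point.\<close>

lemma finsum_fun_module:
  assumes "abelian_group (fun_module C)" "finite I" "f \<in> I \<rightarrow> C"
  shows "finsum (fun_module C) f I = (\<lambda>v. \<Sum>i\<in>I. f i v)"
proof -
  interpret abelian_group "fun_module C"
    by fact
  have carrier: "carrier (fun_module C) = C"
    by (simp add: fun_module_def)
  show ?thesis
    using assms(2,3)
  proof induction
    case empty
    show ?case
      unfolding finsum_empty by (simp add: fun_module_def)
  next
    case (insert i I)
    then have "finsum (fun_module C) f (insert i I) =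
        f i \<oplus>\<^bsub>fun_module C\<^esub> finsum (fun_module C) f I"
      by (intro finsum_insert) (auto simp: carrier)
    with insert show ?case
      by (auto simp: fun_module_def)
  qed
qed

section \<open>Relative invariants of a cyclic character\<close>

lemma rel_invariant_polys_add:
  "f \<in> rel_invariant_polys scl B \<rho> K \<xi> \<Longrightarrow> g \<in> rel_invariant_polys scl B \<rho> K \<xi> \<Longrightarrow>
    (\<lambda>v. f v + g v) \<in> rel_invariant_polys scl B \<rho> K \<xi>"
  by (auto simp: rel_invariant_polys_def algebra_simps intro: poly_fun.add)

lemma rel_invariant_polys_uminus:
  "f \<in> rel_invariant_polys scl B \<rho> K \<xi> \<Longrightarrow> (\<lambda>v. - f v) \<in> rel_invariant_polys scl B \<rho> K \<xi>"
  by (auto simp: rel_invariant_polys_def intro: poly_fun_uminus)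

lemma rel_invariant_polys_zero: "(\<lambda>_. 0) \<in> rel_invariant_polys scl B \<rho> K \<xi>"
  by (auto simp: rel_invariant_polys_def intro: poly_fun.const)

lemma rel_invariant_polys_mult:
  "f \<in> rel_invariant_polys scl B \<rho> K \<xi> \<Longrightarrow> g \<in> rel_invariant_polys scl B \<rho> K \<eta> \<Longrightarrow>
    (\<lambda>v. f v * g v) \<in> rel_invariant_polys scl B \<rho> K (\<lambda>\<gamma>. \<xi> \<gamma> * \<eta> \<gamma>)"
  by (auto simp: rel_invariant_polys_def algebra_simps intro: poly_fun.mult)

text \<open>Treating invariants as the case of the trivial character lets one set of closure lemmas
  serve both the ring and its modules.\<close>

lemma invariant_polys_eq_rel: "invariant_polys scl B \<rho> K = rel_invariant_polys scl B \<rho> K (\<lambda>_. 1)"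
  by (simp add: invariant_polys_def rel_invariant_polys_def)

lemma invariant_polys_one: "(\<lambda>_. 1) \<in> invariant_polys scl B \<rho> K"
  by (auto simp: invariant_polys_def intro: poly_fun.const)

lemma rel_invariant_polys_smult:
  assumes "f \<in> invariant_polys scl B \<rho> K" "g \<in> rel_invariant_polys scl B \<rho> K \<xi>"
  shows "(\<lambda>v. f v * g v) \<in> rel_invariant_polys scl B \<rho> K \<xi>"
  using rel_invariant_polys_mult[of f scl B \<rho> K "\<lambda>_. 1" g \<xi>] assms
  by (simp add: invariant_polys_eq_rel)

lemma invariant_polys_antimono:
  "K \<subseteq> L \<Longrightarrow> invariant_polys scl B \<rho> L \<subseteq> invariant_polys scl B \<rho> K"
  by (auto simp: invariant_polys_def)

lemma cring_invariant_polys: "cring (fun_ring (invariant_polys scl B \<rho> K))"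
  by (intro cring_fun_ring invariant_polys_one)
    (auto simp: invariant_polys_eq_rel
      intro: rel_invariant_polys_add rel_invariant_polys_uminus rel_invariant_polys_zero
        rel_invariant_polys_smult[unfolded invariant_polys_eq_rel])

lemma abelian_group_invariant_polys: "abelian_group (fun_module (invariant_polys scl B \<rho> K))"
  unfolding invariant_polys_eq_rel
  by (intro abelian_group_fun_module rel_invariant_polys_add rel_invariant_polys_uminus
      rel_invariant_polys_zero)

text \<open>Invariance under the larger group \<open>L\<close> implies invariance under
  \<open>K\<close>, so such scalars preserve the \<open>K\<close>-invariants. The later case is
  \<open>K = H\<close> inside the whole group.\<close>

lemma module_invariant_polys:
  assumes "K \<subseteq> L"
  shows "Module.module (fun_ring (invariant_polys scl B \<rho> L)) (fun_module (invariant_polys scl B \<rho> K))"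
proof (intro module_fun_module cring_invariant_polys abelian_group_invariant_polys)
  fix f g
  assume "f \<in> invariant_polys scl B \<rho> L" "g \<in> invariant_polys scl B \<rho> K"
  then show "(\<lambda>v. f v * g v) \<in> invariant_polys scl B \<rho> K"
    using subsetD[OF invariant_polys_antimono[OF assms]]
    unfolding invariant_polys_eq_rel[of _ _ _ K]
    by (intro rel_invariant_polys_smult) (simp_all add: invariant_polys_eq_rel)
qed

locale cyclic_character_action =
  finite_dimensional_vector_space scl B + group_action G UNIV \<rho>
  for scl :: "complex \<Rightarrow> 'v::ab_group_add \<Rightarrow> 'v" and B :: "'v set"
    and G :: "('g, 'm) monoid_scheme" (structure) and \<rho> :: "'g \<Rightarrow> 'v \<Rightarrow> 'v" +
  fixes m :: nat and \<sigma> :: "'g \<Rightarrow> complex"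
  assumes linear_action: "g \<in> carrier G \<Longrightarrow> Vector_Spaces.linear scl scl (\<rho> g)"
    and m_pos: "m > 0"
    and epi: "\<sigma> \<in> epi G (root_group m)"
begin

sublocale group G
  using group_hom by (rule group_hom.axioms(1))

abbreviation "H \<equiv> kernel G (root_group m) \<sigma>"
abbreviation "relinv j \<equiv> rel_invariant_polys scl B \<rho> (carrier G) (\<lambda>\<gamma>. \<sigma> \<gamma> ^ j)"

lemma char_mult: "g \<in> carrier G \<Longrightarrow> h \<in> carrier G \<Longrightarrow> \<sigma> (g \<otimes> h) = \<sigma> g * \<sigma> h"
  using epi by (auto simp: epi_def hom_def root_group_def)

lemma char_image: "\<sigma> ` carrier G = {\<zeta>. \<zeta> ^ m = 1}"
  using epi by (auto simp: epi_def root_group_def)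

lemma char_root: "g \<in> carrier G \<Longrightarrow> \<sigma> g ^ m = 1"
  using char_image by auto

lemma char_nonzero: "g \<in> carrier G \<Longrightarrow> \<sigma> g \<noteq> 0"
  using char_root[of g] m_pos by (auto simp: power_0_left)

lemma kernel_iff: "g \<in> H \<longleftrightarrow> g \<in> carrier G \<and> \<sigma> g = 1"
  by (simp add: kernel_def root_group_def)

lemma action_mult:
  "g \<in> carrier G \<Longrightarrow> h \<in> carrier G \<Longrightarrow> \<rho> (g \<otimes> h) x = \<rho> g (\<rho> h x)"
  by (rule composition_rule) auto

section \<open>Fourier components of a kernel-invariant function\<close>

lemma kernel_invariant_depends_on_char:
  assumes f: "f \<in> invariant_polys scl B \<rho> H"
    and g: "g \<in> carrier G" and h: "h \<in> carrier G" and eq: "\<sigma> g = \<sigma> h"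
  shows "f (\<rho> g x) = f (\<rho> h x)"
proof -
  \<comment> \<open>Equal character values put this quotient in the kernel. As the left factor of
    \<open>g\<close> it acts last, directly under \<open>f\<close>, which absorbs it.\<close>
  define k where "k = g \<otimes> inv h"
  have k: "k \<in> carrier G" and g_eq: "g = k \<otimes> h"
    using g h by (auto simp: k_def m_assoc)
  then have "\<sigma> k * \<sigma> h = \<sigma> h"
    using char_mult[of k h] h eq by simp
  then have "k \<in> H"
    using char_nonzero[OF h] k by (simp add: kernel_iff)
  moreover have "\<rho> g x = \<rho> k (\<rho> h x)"
    unfolding g_eq by (rule action_mult[OF k h])
  ultimately show ?thesis
    using f by (simp add: invariant_polys_def)
qed

text \<open>An arbitrary section of \<open>\<sigma>\<close>, not assumed multiplicative; functions
  invariant under \<open>H\<close> do not see which preimage is chosen.\<close>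

definition lift :: "complex \<Rightarrow> 'g" where
  "lift = inv_into (carrier G) \<sigma>"

lemma lift:
  assumes "\<zeta> ^ m = 1"
  shows lift_closed: "lift \<zeta> \<in> carrier G" and char_lift: "\<sigma> (lift \<zeta>) = \<zeta>"
  using assms char_image unfolding lift_def
  by (auto intro!: inv_into_into f_inv_into_f)

text \<open>On the invariants of \<open>H\<close> this is the projection to the part of type
  \<open>\<sigma>^j\<close>: an average over the quotient by \<open>H\<close>, cyclic of order
  \<open>m\<close>, weighted by the inverse character.\<close>

definition component :: "nat \<Rightarrow> ('v \<Rightarrow> complex) \<Rightarrow> 'v \<Rightarrow> complex" where
  "component j f x = (\<Sum>\<zeta> | \<zeta> ^ m = 1. inverse \<zeta> ^ j * f (\<rho> (lift \<zeta>) x)) / of_nat m"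

lemma component_relinv:
  assumes f: "f \<in> invariant_polys scl B \<rho> H"
  shows "component j f \<in> relinv j"
proof -
  have "poly_fun scl B f"
    using f by (simp add: invariant_polys_def)
  then have "poly_fun scl B (\<lambda>x. f (\<rho> (lift \<zeta>) x))" if "\<zeta> ^ m = 1" for \<zeta>
    by (rule poly_fun_linear_image[OF finite_dimensional_vector_space_axioms _
          linear_action[OF lift_closed[OF that]]])
  \<comment> \<open>Division by \<open>m\<close> is recast as multiplication by a constant, a form
    covered by the closure rules.\<close>
  then have "poly_fun scl B (\<lambda>x. inverse (of_nat m) *
      (\<Sum>\<zeta> | \<zeta> ^ m = 1. inverse \<zeta> ^ j * f (\<rho> (lift \<zeta>) x)))"
    by (intro poly_fun.mult poly_fun.const poly_fun_sum) auto
  then have "poly_fun scl B (component j f)"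
    by (simp add: component_def[abs_def] divide_inverse mult.commute)
  moreover have "component j f (\<rho> g x) = \<sigma> g ^ j * component j f x" if g: "g \<in> carrier G" for g x
  proof -
    \<comment> \<open>Acting by \<open>g\<close> moves the term at \<open>\<zeta>\<close> to the
      term at \<open>\<zeta> * \<sigma> g\<close>. The elements
      \<open>lift \<zeta> \<otimes> g\<close> and \<open>lift (\<zeta> * \<sigma> g)\<close> may
      differ but share their character value; correcting the weight costs the factor
      \<open>\<sigma> g ^ j\<close>.\<close>
    have "inverse \<zeta> ^ j * f (\<rho> (lift \<zeta>) (\<rho> g x)) =
        \<sigma> g ^ j * (inverse (\<zeta> * \<sigma> g) ^ j * f (\<rho> (lift (\<zeta> * \<sigma> g)) x))" if "\<zeta> ^ m = 1" for \<zeta>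
    proof -
      have root: "(\<zeta> * \<sigma> g) ^ m = 1"
        using that char_root[OF g] by (simp add: power_mult_distrib)
      have "f (\<rho> (lift \<zeta>) (\<rho> g x)) = f (\<rho> (lift \<zeta> \<otimes> g) x)"
        using that g by (simp add: action_mult lift_closed)
      also have "\<dots> = f (\<rho> (lift (\<zeta> * \<sigma> g)) x)"
        using that g root
        by (intro kernel_invariant_depends_on_char[OF f])
          (auto simp: lift_closed char_lift char_mult)
      finally show ?thesis
        using char_nonzero[OF g] by (simp add: power_mult_distrib power_inverse)
    qed
    then have "(\<Sum>\<zeta> | \<zeta> ^ m = 1. inverse \<zeta> ^ j * f (\<rho> (lift \<zeta>) (\<rho> g x))) =
        \<sigma> g ^ j * (\<Sum>\<zeta> | \<zeta> ^ m = 1. inverse (\<zeta> * \<sigma> g) ^ j * f (\<rho> (lift (\<zeta> * \<sigma> g)) x))"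
      by (simp add: sum_distrib_left)
    also have "\<dots> = \<sigma> g ^ j * (\<Sum>\<zeta> | \<zeta> ^ m = 1. inverse \<zeta> ^ j * f (\<rho> (lift \<zeta>) x))"
      by (subst sum.reindex_bij_betw[OF roots_unity_times_bij[OF char_root[OF g] m_pos]]) simp
    finally show ?thesis
      by (simp add: component_def)
  qed
  ultimately show ?thesis
    by (simp add: rel_invariant_polys_def)
qed

text \<open>After exchanging the sums, the geometric sum over \<open>j\<close> vanishes at every
  root except \<open>\<zeta> = 1\<close>, where it equals \<open>m\<close> and cancels the
  normalization.\<close>

lemma sum_components:
  assumes f: "f \<in> invariant_polys scl B \<rho> H"
  shows "(\<Sum>j<m. component j f x) = f x"
proof -
  have fin: "finite {\<zeta>::complex. \<zeta> ^ m = 1}"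
    using finite_roots_unity[of m] m_pos by simp
  have "(\<Sum>j<m. component j f x) =
      (\<Sum>j<m. \<Sum>\<zeta> | \<zeta> ^ m = 1. inverse \<zeta> ^ j * f (\<rho> (lift \<zeta>) x)) / of_nat m"
    unfolding component_def by (rule sum_divide_distrib[symmetric])
  also have "(\<Sum>j<m. \<Sum>\<zeta> | \<zeta> ^ m = 1. inverse \<zeta> ^ j * f (\<rho> (lift \<zeta>) x)) =
      (\<Sum>\<zeta> | \<zeta> ^ m = 1. \<Sum>j<m. inverse \<zeta> ^ j * f (\<rho> (lift \<zeta>) x))"
    by (rule sum.swap)
  also have "\<dots> = (\<Sum>\<zeta> | \<zeta> ^ m = 1. (\<Sum>j<m. inverse \<zeta> ^ j) * f (\<rho> (lift \<zeta>) x))"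
    by (simp only: sum_distrib_right)
  also have "\<dots> = (\<Sum>\<zeta> | \<zeta> ^ m = 1. if \<zeta> = 1 then of_nat m * f (\<rho> (lift \<zeta>) x) else 0)"
  proof (intro sum.cong refl)
    fix \<zeta> :: complex
    assume "\<zeta> \<in> {\<zeta>. \<zeta> ^ m = 1}"
    then have "inverse \<zeta> ^ m = 1"
      by (simp add: power_inverse)
    then show "(\<Sum>j<m. inverse \<zeta> ^ j) * f (\<rho> (lift \<zeta>) x) =
        (if \<zeta> = 1 then of_nat m * f (\<rho> (lift \<zeta>) x) else 0)"
      by (simp only: sum_powers_root_unity inverse_eq_1_iff) simp
  qed
  also have "\<dots> = of_nat m * f (\<rho> (lift 1) x)"
    using fin by (simp add: sum.delta)
  \<comment> \<open>\<open>lift 1\<close> need not be the identity, but it lies in the kernel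
    \<open>H\<close>, under which \<open>f\<close> is invariant.\<close>
  also have "f (\<rho> (lift 1) x) = f x"
    using f lift[of 1] by (simp add: invariant_polys_def kernel_iff)
  finally show ?thesis
    using m_pos by simp
qed

section \<open>Independence of the summands\<close>

lemma relinv_independent:
  assumes d: "\<And>j. j < m \<Longrightarrow> d j \<in> relinv j" and zero: "\<And>x. (\<Sum>j<m. d j x) = 0" and "j < m"
  shows "d j x = 0"
proof (rule coeffs_zero_if_vanishing_at_roots_unity[OF m_pos _ \<open>j < m\<close>])
  fix \<zeta> :: complex
  assume \<zeta>: "\<zeta> ^ m = 1"
  \<comment> \<open>With \<open>x\<close> fixed, the values \<open>d j x\<close> are the
    coefficients of a polynomial in \<open>\<zeta>\<close>; relative invariance identifies its value
    at a root of unity with the vanishing sum at another point of the orbit.\<close>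
  have "(\<Sum>j<m. d j x * \<zeta> ^ j) = (\<Sum>j<m. d j (\<rho> (lift \<zeta>) x))"
    using d lift[OF \<zeta>] by (intro sum.cong) (auto simp: rel_invariant_polys_def)
  then show "(\<Sum>j<m. d j x * \<zeta> ^ j) = 0"
    using zero by simp
qed

section \<open>Submodules and the direct sum decomposition\<close>

lemma relinv_subset: "relinv j \<subseteq> invariant_polys scl B \<rho> H"
  by (auto simp: rel_invariant_polys_def invariant_polys_def kernel_iff)

lemma submodule_relinv:
  "submodule (relinv j) (fun_ring (invariant_polys scl B \<rho> (carrier G)))
    (fun_module (invariant_polys scl B \<rho> H))"
proof (rule Module.module.submoduleI)
  show "Module.module (fun_ring (invariant_polys scl B \<rho> (carrier G)))
      (fun_module (invariant_polys scl B \<rho> H))"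
    by (rule module_invariant_polys) (auto simp: kernel_iff)
  \<comment> \<open>The abstract additive inverse must first be identified with pointwise
    negation.\<close>
  show "\<ominus>\<^bsub>fun_module (invariant_polys scl B \<rho> H)\<^esub> f \<in> relinv j" if "f \<in> relinv j" for f
    using that relinv_subset
    by (subst a_inv_fun_module)
      (auto intro: abelian_group_invariant_polys rel_invariant_polys_uminus)
qed (use relinv_subset in \<open>auto simp: fun_module_def fun_ring_def
      intro: rel_invariant_polys_zero rel_invariant_polys_add rel_invariant_polys_smult\<close>)

theorem internal_direct_sum_relinv:
  "internal_direct_sum (fun_ring (invariant_polys scl B \<rho> (carrier G)))
    (fun_module (invariant_polys scl B \<rho> H)) {..<m} relinv"
  unfolding internal_direct_sum_def
proof (intro conjI ballI submodule_relinv)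
  show "Module.module (fun_ring (invariant_polys scl B \<rho> (carrier G)))
      (fun_module (invariant_polys scl B \<rho> H))"
    by (rule module_invariant_polys) (auto simp: kernel_iff)
next
  fix f
  assume "f \<in> carrier (fun_module (invariant_polys scl B \<rho> H))"
  then have f: "f \<in> invariant_polys scl B \<rho> H"
    by (simp add: fun_module_def)
  have finsum: "finsum (fun_module (invariant_polys scl B \<rho> H)) h {..<m} = (\<lambda>x. \<Sum>j<m. h j x)"
    if "h \<in> Pi\<^sub>E {..<m} relinv" for h
    using that relinv_subset by (intro finsum_fun_module abelian_group_invariant_polys) blast+
  \<comment> \<open>Restriction makes the family \<open>undefined\<close> outside
    \<open>{..<m}\<close>, as membership in \<open>Pi\<^sub>E\<close> demands; otherwise uniqueness
    could fail off the index set.\<close>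
  let ?c = "\<lambda>j\<in>{..<m}. component j f"
  have c: "?c \<in> Pi\<^sub>E {..<m} relinv"
    using component_relinv[OF f] by simp
  show "\<exists>!h. h \<in> Pi\<^sub>E {..<m} relinv \<and>
      f = finsum (fun_module (invariant_polys scl B \<rho> H)) h {..<m}"
  proof (rule ex1I[of _ ?c])
    show "?c \<in> Pi\<^sub>E {..<m} relinv \<and>
        f = finsum (fun_module (invariant_polys scl B \<rho> H)) ?c {..<m}"
      using c finsum[OF c] sum_components[OF f] by auto
  next
    fix h
    assume h: "h \<in> Pi\<^sub>E {..<m} relinv \<and>
        f = finsum (fun_module (invariant_polys scl B \<rho> H)) h {..<m}"
    then have f_eq: "f = (\<lambda>x. \<Sum>j<m. h j x)"
      using finsum by simp
    \<comment> \<open>Two decompositions of \<open>f\<close> differ by a family of relative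
      invariants with sum zero, so independence applies.\<close>
    have "h j x - component j f x = 0" if "j < m" for j x
    proof (rule relinv_independent[OF _ _ that])
      show "(\<lambda>x. h i x - component i f x) \<in> relinv i" if "i < m" for i
        using rel_invariant_polys_add[OF _ rel_invariant_polys_uminus[OF component_relinv[OF f]]]
          h that by fastforce
      show "(\<Sum>i<m. h i y - component i f y) = 0" for y
        using sum_components[OF f, of y] fun_cong[OF f_eq, of y] by (simp add: sum_subtractf)
    qed
    then show "h = ?c"
      by (intro PiE_ext[OF conjunct1[OF h] c]) (simp add: fun_eq_iff)
  qed
qed

end

section \<open>Specialization to compact Lie group actions\<close>

theorem theorem2p4:
  fixes \<Gamma> :: "('g, 'm) monoid_scheme"
    and T :: "'g topology" and n :: nat and A :: "('g set \<times> ('g \<Rightarrow> nat \<Rightarrow> real)) set"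
    and scl :: "complex \<Rightarrow> 'v::ab_group_add \<Rightarrow> 'v" and B :: "'v set"
    and \<rho> :: "'g \<Rightarrow> 'v \<Rightarrow> 'v"
    and m :: nat and \<sigma> :: "'g \<Rightarrow> complex" and H :: "'g set"
  assumes "linear_lie_group_action \<Gamma> T n A scl B \<rho>"
    and "m \<ge> 2"
    and "\<sigma> \<in> epi \<Gamma> (root_group m)"
    and "H = kernel \<Gamma> (root_group m) \<sigma>"
  shows "rel_invariant_polys scl B \<rho> (carrier \<Gamma>) (\<lambda>\<gamma>. \<sigma> \<gamma> ^ 0) = invariant_polys scl B \<rho> (carrier \<Gamma>) \<and>
    internal_direct_sum
      (fun_ring (invariant_polys scl B \<rho> (carrier \<Gamma>)))
      (fun_module (invariant_polys scl B \<rho> H))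
      {0..m-1}
      (\<lambda>j. rel_invariant_polys scl B \<rho> (carrier \<Gamma>) (\<lambda>\<gamma>. \<sigma> \<gamma> ^ j))"
proof -
  interpret linear_lie_group_action \<Gamma> T n A scl B \<rho>
    by fact
  interpret cyclic_character_action scl B \<Gamma> \<rho> m \<sigma>
    using assms(2,3) linear_action
    by (intro cyclic_character_action.intro cyclic_character_action_axioms.intro
        finite_dimensional_vector_space_axioms group_action_axioms) simp_all
  \<comment> \<open>Natural subtraction truncates, so this relies on \<open>m\<close> being
    positive.\<close>
  have "{0..m-1} = {..<m}"
    using assms(2) by auto
  then show ?thesis
    unfolding assms(4) using internal_direct_sum_relinv
    by (simp only: power_0 invariant_polys_eq_rel)
qed

end
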